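(* Let $R$ be an integral domain of characteristic $0$, $n,m\ge1$, and $a_{l,i,j},b_{l,j}\in R$ for $1\le l,i\le n$, $1\le j\le m$. Let $$F(\mathbf{x})=\begin{pmatrix}\prod_{j=1}^m\left(\sum_{i=1}^n a_{1,i,j}x_i+b_{1,j}\right)\\ \vdots\\ \prod_{j=1}^m\left(\sum_{i=1}^n a_{n,i,j}x_i+b_{n,j}\right)\end{pmatrix}.$$ Put $A_j=(a_{l,i,j})_{l,i=1}^n$ and $\mathbf{b}_j=(b_{1,j},\dots,b_{n,j})^\top$. Then the equation $\mathbf{x}'=F(\mathbf{x})$ has solution $$\Phi(t,\mathbf{x},F(\mathbf{x}))=\bigodot_{j=1}^{m}\left(e^{tA_j}\mathbf{x}+\int_0^t e^{(t-s)A_j}\mathbf{b}_j\,ds\right),$$ where $\odot$ is the product of the ring of flows $\rho_t\mathfrak{A}_T(\mathbf{x})$, $T=H_R^n[[\mathbf{x}]]$.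
   Context: $\mathbb{N}=\{0,1,2,\dots\}$. $H_R[[\mathbf{x}]]$ is the ring of formal series $\sum_{\mathbf r\in\mathbb{N}^n}a_{\mathbf r}\frac{x_1^{r_1}\cdots x_n^{r_n}}{r_1!\cdots r_n!}$ with $a_{\mathbf r}\in R$ (usual operations of power series; it may be viewed inside $\mathrm{Frac}(R)[[x_1,\dots,x_n]]$). $T=H_R^n[[\mathbf{x}]]$ is the direct product of $n$ copies of it, with componentwise sum and product $\cdot$; as an element of $T$, $\mathbf{x}=(x_1,\dots,x_n)$. For $\phi,G\in T$, $\mathfrak{D}_\phi(G)$ has $i$-th component $\sum_{l}\frac{\partial g_i}{\partial x_l}\phi_l$, and $\mathfrak{D}_\phi^r$ is its $r$-th iterate ($\mathfrak{D}^0_\phi(G)=G$). The flow of $\phi$ is the formal series in $t$ with coefficients in $T$ $$\Phi(t,\mathbf{x},\phi(\mathbf{x}))=\rho_t\mathfrak{A}_\phi(\mathbf{x})=\mathbf{x}+\sum_{r\ge1}\mathfrak{D}_\phi^r(\mathbf{x})\frac{t^r}{r!},$$ and a solution of $\mathbf{x}'=F(\mathbf{x})$ is a formal series $\Phi$ with $\frac{\partial}{\partial t}\Phi=F(\Phi)$ and $\Phi|_{t=0}=\mathbf{x}$. $\rho_t\mathfrak{A}_T(\mathbf{x})=\{\rho_t\mathfrak{A}_\phi(\mathbf{x}):\phi\in T\}$, and its product is $\rho_t\mathfrak{A}_\phi(\mathbf{x})\odot\rho_t\mathfrak{A}_\psi(\mathbf{x})=\sum_{r\ge0}C_r(\phi,\psi)\frac{t^r}{r!}$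 with $C_0=\mathbf{x}$ and $C_r=\sum_{l=0}^{r-1}\binom{r-1}{l}\mathfrak{D}_{\phi\cdot\psi}^{l}(\mathfrak{D}_\phi(\mathbf{x}))\cdot\mathfrak{D}_{\phi\cdot\psi}^{r-1-l}(\mathfrak{D}_\psi(\mathbf{x}))$ for $r\ge1$. Exponentials and integrals are formal: $e^{tA}\mathbf{x}=\sum_{r\ge0}A^r\mathbf{x}\frac{t^r}{r!}$ and $\int_0^te^{(t-s)A}\mathbf{b}\,ds=\sum_{r\ge0}A^r\mathbf{b}\frac{t^{r+1}}{(r+1)!}$. *)

theory Defs
  imports
    "HOL-Analysis.Finite_Cartesian_Product"
    "HOL-Library.Groups_Big_Fun"
    "HOL-Computational_Algebra.Fraction_Field"
begin

text \<open>
  A formal series \<open>\<Sum>\<^sub>r a\<^sub>r x\<^sup>r / r!\<close> (multi-index notation, variables indexed by the finite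
  type \<open>'n\<close>) is represented by its coefficient family \<open>r \<mapsto> a\<^sub>r\<close>; note that the factor
  \<open>1 / r!\<close> is not part of the coefficient.
\<close>

typedef ('a, 'n) hurwitz = "UNIV :: (('n \<Rightarrow> nat) \<Rightarrow> 'a) set"
  morphisms hcoeff Abs_hurwitz ..

setup_lifting type_definition_hurwitz

lemma hurwitz_eqI: "(\<And>r. hcoeff f r = hcoeff g r) \<Longrightarrow> f = g"
  by transfer auto

definition mbinom :: "('n::finite \<Rightarrow> nat) \<Rightarrow> ('n \<Rightarrow> nat) \<Rightarrow> nat" where
  "mbinom r s = (\<Prod>i\<in>UNIV. r i choose s i)"

lemma finite_atMost_multiindex [simp]:
  fixes r :: "'n::finite \<Rightarrow> nat"
  shows "finite {..r}"
proof -
  have "{..r} \<subseteq> (\<Pi>\<^sub>E i \<in> UNIV. {..r i})"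
    by (auto simp: le_fun_def PiE_def extensional_def)
  then show ?thesis
    by (rule finite_subset) (auto intro: finite_PiE)
qed

lemma mbinom_symmetric: "s \<le> r \<Longrightarrow> mbinom r (r - s) = mbinom r s"
  unfolding mbinom_def
  by (intro prod.cong refl) (simp add: le_fun_def binomial_symmetric [symmetric])

lemma mbinom_mult:
  assumes "u \<le> s" "s \<le> r"
  shows "mbinom r s * mbinom s u = mbinom r u * mbinom (r - u) (s - u)"
proof -
  have "(r i choose s i) * (s i choose u i) = (r i choose u i) * ((r - u) i choose (s - u) i)" for i
    unfolding minus_apply by (rule choose_mult) (use assms in \<open>simp_all add: le_fun_def\<close>)
  then show ?thesis
    by (simp add: mbinom_def prod.distrib [symmetric] del: minus_apply)
qed

instantiation hurwitz :: (comm_ring_1, finite) comm_ring_1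
begin

lift_definition zero_hurwitz :: "('a, 'b) hurwitz" is "\<lambda>_. 0" .

lift_definition one_hurwitz :: "('a, 'b) hurwitz" is "\<lambda>r. if r = (\<lambda>_. 0) then 1 else 0" .

lift_definition plus_hurwitz :: "('a, 'b) hurwitz \<Rightarrow> ('a, 'b) hurwitz \<Rightarrow> ('a, 'b) hurwitz"
  is "\<lambda>f g r. f r + g r" .

lift_definition minus_hurwitz :: "('a, 'b) hurwitz \<Rightarrow> ('a, 'b) hurwitz \<Rightarrow> ('a, 'b) hurwitz"
  is "\<lambda>f g r. f r - g r" .

lift_definition uminus_hurwitz :: "('a, 'b) hurwitz \<Rightarrow> ('a, 'b) hurwitz"
  is "\<lambda>f r. - f r" .

text \<open>
  The usual product of power series: the binomials come from
  \<open>x\<^sup>s / s! \<cdot> x\<^sup>u / u! = (s+u choose s) x\<^bsup>s+u\<^esup> / (s+u)!\<close>.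
\<close>

lift_definition times_hurwitz :: "('a, 'b) hurwitz \<Rightarrow> ('a, 'b) hurwitz \<Rightarrow> ('a, 'b) hurwitz"
  is "\<lambda>f g r. \<Sum>s\<in>{..r}. of_nat (mbinom r s) * f s * g (r - s)" .

instance
proof
  fix f g h :: "('a, 'b) hurwitz"
  have diff_diff: "r - (r - s) = s" if "s \<le> r" for r s :: "'b \<Rightarrow> nat"
    using that by (auto simp: fun_eq_iff le_fun_def)
  have diff_le: "r - s \<le> r" for r s :: "'b \<Rightarrow> nat"
    by (auto simp: le_fun_def)
  show "f * g * h = f * (g * h)"
  proof (rule hurwitz_eqI)
    fix r :: "'b \<Rightarrow> nat"
    let ?f = "hcoeff f" and ?g = "hcoeff g" and ?h = "hcoeff h"
    have "hcoeff (f * g * h) r =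
      (\<Sum>(s, u)\<in>(SIGMA s:{..r}. {..s}).
        of_nat (mbinom r s * mbinom s u) * ?f u * ?g (s - u) * ?h (r - s))"
      by (simp add: times_hurwitz.rep_eq sum.Sigma [symmetric] sum_distrib_left sum_distrib_right
          mult_ac)
    also have "\<dots> =
      (\<Sum>(u, v)\<in>(SIGMA u:{..r}. {..r - u}).
        of_nat (mbinom r u * mbinom (r - u) v) * ?f u * ?g v * ?h (r - u - v))"
    proof (rule sum.reindex_bij_witness
        [where i = "\<lambda>(u, v). (\<lambda>i. u i + v i, u)" and j = "\<lambda>(s, u). (u, s - u)"])
      fix p assume "p \<in> (SIGMA s:{..r}. {..s})"
      then obtain s u where p: "p = (s, u)" "s \<le> r" "u \<le> s" by auto
      then have "u \<le> r" by simp
      show "(\<lambda>(u, v). (\<lambda>i. u i + v i, u)) ((\<lambda>(s, u). (u, s - u)) p) = p"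
        using p by (auto simp: fun_eq_iff le_fun_def)
      show "(\<lambda>(s, u). (u, s - u)) p \<in> (SIGMA u:{..r}. {..r - u})"
        using p \<open>u \<le> r\<close> by (auto simp: le_fun_def diff_le_mono)
      have "r - u - (s - u) = r - s"
        using p by (auto simp: fun_eq_iff le_fun_def)
      then show "(case (\<lambda>(s, u). (u, s - u)) p of (u, v) \<Rightarrow>
            of_nat (mbinom r u * mbinom (r - u) v) * ?f u * ?g v * ?h (r - u - v)) =
          (case p of (s, u) \<Rightarrow>
            of_nat (mbinom r s * mbinom s u) * ?f u * ?g (s - u) * ?h (r - s))"
        using p by (simp only: case_prod_conv mbinom_mult)
    next
      fix p assume "p \<in> (SIGMA u:{..r}. {..r - u})"
      then obtain u v where p: "p = (u, v)" "u \<le> r" "v \<le> r - u" by auto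
      have "u i + v i \<le> r i" for i
        using p(2,3)[unfolded le_fun_def, rule_format, of i] by simp
      with p show "(\<lambda>(u, v). (\<lambda>i. u i + v i, u)) p \<in> (SIGMA s:{..r}. {..s})"
        by (auto simp: le_fun_def)
      show "(\<lambda>(s, u). (u, s - u)) ((\<lambda>(u, v). (\<lambda>i. u i + v i, u)) p) = p"
        using p by (auto simp: fun_eq_iff)
    qed
    also have "\<dots> = hcoeff (f * (g * h)) r"
      by (simp add: times_hurwitz.rep_eq sum.Sigma [symmetric] sum_distrib_left sum_distrib_right
          mult_ac)
    finally show "hcoeff (f * g * h) r = hcoeff (f * (g * h)) r" .
  qed
  show "f * g = g * f"
  proof (rule hurwitz_eqI)
    fix r :: "'b \<Rightarrow> nat"
    show "hcoeff (f * g) r = hcoeff (g * f) r"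
      unfolding times_hurwitz.rep_eq
      by (rule sum.reindex_bij_witness [where i = "\<lambda>s. r - s" and j = "\<lambda>s. r - s"])
        (auto simp: diff_diff diff_le mbinom_symmetric mult_ac)
  qed
  show "1 * f = f"
  proof (rule hurwitz_eqI)
    fix r :: "'b \<Rightarrow> nat"
    have zero: "(\<lambda>_. 0) \<in> {..r}" by (auto simp: le_fun_def)
    have "hcoeff (1 * f) r =
      (\<Sum>s\<in>{..r}. if s = (\<lambda>_. 0) then of_nat (mbinom r s) * hcoeff f (r - s) else 0)"
      unfolding times_hurwitz.rep_eq one_hurwitz.rep_eq by (intro sum.cong refl) auto
    also have "\<dots> = of_nat (mbinom r (\<lambda>_. 0)) * hcoeff f (r - (\<lambda>_. 0))"
      using zero by (simp add: sum.delta)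
    also have "\<dots> = hcoeff f r"
      by (simp add: mbinom_def fun_diff_def)
    finally show "hcoeff (1 * f) r = hcoeff f r" .
  qed
  show "(f + g) * h = f * h + g * h"
    by (rule hurwitz_eqI)
      (simp add: times_hurwitz.rep_eq plus_hurwitz.rep_eq algebra_simps sum.distrib)
  show "f + g + h = f + (g + h)" "f + g = g + f" "0 + f = f" "- f + f = 0" "f - g = f + - g"
    by (transfer, simp add: fun_eq_iff algebra_simps)+
  show "(0 :: ('a, 'b) hurwitz) \<noteq> 1"
    by transfer (auto simp: fun_eq_iff)
qed

end

definition hmap :: "('a \<Rightarrow> 'b) \<Rightarrow> ('a, 'n) hurwitz \<Rightarrow> ('b, 'n) hurwitz" where
  "hmap h f = Abs_hurwitz (\<lambda>r. h (hcoeff f r))"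

definition hconst :: "'a::zero \<Rightarrow> ('a, 'n) hurwitz" where
  "hconst c = Abs_hurwitz (\<lambda>r. if r = (\<lambda>_. 0) then c else 0)"

definition hvar :: "'n \<Rightarrow> ('a::zero_neq_one, 'n) hurwitz" where
  "hvar i = Abs_hurwitz (\<lambda>r. if r = (\<lambda>k. if k = i then 1 else 0) then 1 else 0)"

text \<open>
  Since \<open>\<partial>/\<partial>x\<^sub>l\<close> maps \<open>x\<^sub>l\<^bsup>k+1\<^esup> / (k+1)!\<close> to \<open>x\<^sub>l\<^bsup>k\<^esup> / k!\<close>, differentiation is a shift of
  the coefficients.
\<close>

definition hderiv :: "'n \<Rightarrow> ('a, 'n) hurwitz \<Rightarrow> ('a, 'n) hurwitz" where
  "hderiv l f = Abs_hurwitz (\<lambda>r. hcoeff f (r(l := Suc (r l))))"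

text \<open>
  \<open>('a, 'n) hvec\<close> is \<open>T\<close>: the operations \<open>+\<close> and \<open>*\<close> of the library on vectors are
  componentwise. A series in \<open>t\<close> over \<open>T\<close> is a series in one variable, indexed by \<open>unit\<close>;
  again \<open>tcoeff \<Phi> k\<close> is the coefficient of \<open>t\<^sup>k / k!\<close>.
\<close>

type_synonym ('a, 'n) hvec = "('a, 'n) hurwitz ^ 'n"

type_synonym ('a, 'n) tseries = "(('a, 'n) hvec, unit) hurwitz"

definition tseries :: "(nat \<Rightarrow> 'b) \<Rightarrow> ('b, unit) hurwitz" where
  "tseries c = Abs_hurwitz (\<lambda>r. c (r ()))"

definition tcoeff :: "('b, unit) hurwitz \<Rightarrow> nat \<Rightarrow> 'b" where
  "tcoeff \<Phi> k = hcoeff \<Phi> (\<lambda>_. k)"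

definition xvec :: "('a::comm_ring_1, 'n::finite) hvec" where
  "xvec = (\<chi> i. hvar i)"

definition Dop :: "('a::comm_ring_1, 'n::finite) hvec \<Rightarrow> ('a, 'n) hvec \<Rightarrow> ('a, 'n) hvec" where
  "Dop \<phi> G = (\<chi> i. \<Sum>l\<in>UNIV. hderiv l (G $ i) * \<phi> $ l)"

definition flow :: "('a::comm_ring_1, 'n::finite) hvec \<Rightarrow> ('a, 'n) tseries" where
  "flow \<phi> = tseries (\<lambda>r. (Dop \<phi> ^^ r) xvec)"

definition flows :: "('a::comm_ring_1, 'n::finite) tseries set" where
  "flows = range flow"

fun flow_prod_coeff ::
    "('a::comm_ring_1, 'n::finite) hvec \<Rightarrow> ('a, 'n) hvec \<Rightarrow> nat \<Rightarrow> ('a, 'n) hvec" where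
  "flow_prod_coeff \<phi> \<psi> 0 = xvec"
| "flow_prod_coeff \<phi> \<psi> (Suc r) =
    (\<Sum>l\<le>r. of_nat (r choose l)
      * (Dop (\<phi> * \<psi>) ^^ l) (Dop \<phi> xvec)
      * (Dop (\<phi> * \<psi>) ^^ (r - l)) (Dop \<psi> xvec))"

text \<open>
  The product of flows is defined through the generating \<open>\<phi>\<close>, which is determined by the flow:
  it is the coefficient of \<open>t\<close>. The value is meaningful for elements of \<^const>\<open>flows\<close> only.
\<close>

definition flow_times ::
    "('a::comm_ring_1, 'n::finite) tseries \<Rightarrow> ('a, 'n) tseries \<Rightarrow> ('a, 'n) tseries"
    (infixl "\<odot>\<^sub>F" 70) where
  "\<Phi> \<odot>\<^sub>F \<Psi> =
    tseries (flow_prod_coeff (THE \<phi>. flow \<phi> = \<Phi>) (THE \<psi>. flow \<psi> = \<Psi>))"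

text \<open>\<open>flow_Prod \<Phi> m = \<Phi> 1 \<odot>\<^sub>F \<dots> \<odot>\<^sub>F \<Phi> m\<close>, for \<open>m \<ge> 1\<close>.\<close>

definition flow_Prod ::
    "(nat \<Rightarrow> ('a::comm_ring_1, 'n::finite) tseries) \<Rightarrow> nat \<Rightarrow> ('a, 'n) tseries" where
  "flow_Prod \<Phi> m = foldl (\<odot>\<^sub>F) (\<Phi> 1) (map \<Phi> [2..<Suc m])"

text \<open>
  Substitution \<open>f(\<Phi>) = \<Sum>\<^sub>r f\<^sub>r / r! \<cdot> \<Phi>\<^sub>1\<^bsup>r\<^sub>1\<^esup> \<cdots> \<Phi>\<^sub>n\<^bsup>r\<^sub>n\<^esup>\<close>. Because of the denominators it is formed
  over the field of fractions, coefficient by coefficient: the inner \<^const>\<open>hcoeff\<close> is that of the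
  power of \<open>t\<close>, the outer one that of the monomial in the \<open>x\<^sub>i\<close>. If \<open>\<Phi>\<close> has constant term \<open>0\<close> as
  a series in \<open>(t, x)\<close>, in particular if \<open>\<Phi>\<close> is \<open>x\<close> at \<open>t = 0\<close>, only finitely many \<open>r\<close> contribute
  to each coefficient; only then is the definition meaningful.
\<close>

definition to_frac :: "'a::idom \<Rightarrow> 'a fract" where
  "to_frac c = Fract c 1"

definition hsubst ::
    "('a::idom, 'n::finite) hurwitz \<Rightarrow> ('a, 'n) tseries \<Rightarrow> (('a fract, 'n) hurwitz, unit) hurwitz"
  where
  "hsubst f \<Phi> = Abs_hurwitz (\<lambda>k. Abs_hurwitz (\<lambda>s.
    Sum_any (\<lambda>r. to_frac (hcoeff f r) / of_nat (\<Prod>i\<in>UNIV. fact (r i))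
      * to_frac (hcoeff (hcoeff (\<Prod>i\<in>UNIV. hmap (\<lambda>v. v $ i) \<Phi> ^ r i) k) s))))"

text \<open>
  \<open>\<Phi>\<close> solves \<open>x' = F(x)\<close>: \<open>\<partial>\<Phi>/\<partial>t = F(\<Phi>)\<close> (as series over the field of fractions) and
  \<open>\<Phi> = x\<close> at \<open>t = 0\<close>.
\<close>

definition is_solution :: "('a::idom, 'n::finite) hvec \<Rightarrow> ('a, 'n) tseries \<Rightarrow> bool" where
  "is_solution F \<Phi> \<longleftrightarrow>
    tcoeff \<Phi> 0 = xvec \<and>
    (\<forall>i. hmap (\<lambda>v. hmap to_frac (v $ i)) (hderiv () \<Phi>) = hsubst (F $ i) \<Phi>)"

definition mat_act ::
    "('a::comm_ring_1)^'n^'n \<Rightarrow> ('a, 'n::finite) hvec \<Rightarrow> ('a, 'n) hvec" where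
  "mat_act A v = (\<chi> l i. hconst (A $ l $ i)) *v v"

definition const_vec :: "('a::comm_ring_1)^'n \<Rightarrow> ('a, 'n::finite) hvec" where
  "const_vec b = (\<chi> l. hconst (b $ l))"

text \<open>\<open>e\<^bsup>tA\<^esup> v = \<Sum>\<^sub>r A\<^sup>r v t\<^sup>r / r!\<close>\<close>

definition exp_series :: "('a::comm_ring_1)^'n^'n \<Rightarrow> ('a, 'n::finite) hvec \<Rightarrow> ('a, 'n) tseries" where
  "exp_series A v = tseries (\<lambda>r. (mat_act A ^^ r) v)"

text \<open>\<open>\<integral>\<^sub>0\<^sup>t e\<^bsup>(t-s)A\<^esup> b ds = \<Sum>\<^sub>r A\<^sup>r b t\<^bsup>r+1\<^esup> / (r+1)!\<close>\<close>

definition int_exp_series :: "('a::comm_ring_1)^'n^'n \<Rightarrow> 'a^'n \<Rightarrow> ('a, 'n::finite) tseries" where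
  "int_exp_series A b =
    tseries (\<lambda>k. case k of 0 \<Rightarrow> 0 | Suc r \<Rightarrow> (mat_act A ^^ r) (const_vec b))"

end

theory Submission
  imports Defs
begin

text \<open>
  Everything rests on one fact: \<open>D = \<Sum>\<^sub>l \<phi>\<^sub>l \<partial>/\<partial>x\<^sub>l\<close> is a derivation, and so is its componentwise
  version \<^const>\<open>Dop\<close> \<open>\<phi>\<close>; the Leibniz rule for the iterates of a derivation is the product rule
  for the coefficients of series in \<open>t\<close>.

  The equation. By Leibniz, \<open>e\<^bsup>tD\<^esup>\<close> is a ring homomorphism into series in \<open>t\<close>. It maps \<open>x\<^sub>i\<close> to the
  component \<open>\<Phi>\<^sub>i\<close> of the flow, hence \<open>x\<^sup>r\<close> to \<open>\<Prod>\<^sub>i \<Phi>\<^sub>i\<^bsup>r\<^sub>i\<^esup>\<close>. Thus substituting the flow into a series \<open>g\<close>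
  amounts to applying \<open>e\<^bsup>tD\<^esup>\<close> to each term \<open>g\<^sub>r x\<^sup>r / r!\<close>. Since \<open>D\<close> lowers the order of a series by
  at most one, each coefficient of \<open>e\<^bsup>tD\<^esup> g\<close> involves only finitely many terms of \<open>g\<close>, so
  \<open>g(\<Phi>) = e\<^bsup>tD\<^esup> g\<close> (\<open>hsubst_flow\<close>). With \<open>g = \<phi>\<^sub>i = D x\<^sub>i\<close> the right-hand side is
  \<open>\<partial>\<Phi>\<^sub>i/\<partial>t\<close>, so every flow solves the equation of its generator (\<open>is_solution_flow\<close>).

  The product. The coefficient \<open>C\<^sub>r\<^sub>+\<^sub>1(\<phi>, \<psi>)\<close> is the Leibniz expansion of the \<open>r\<close>-th iterate of
  \<^const>\<open>Dop\<close> \<open>(\<phi> * \<psi>)\<close> at \<open>\<phi> * \<psi>\<close>. Therefore the product of flows is the flow of the product of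
  the generators (\<open>flow_times_flow\<close>). As \<open>F\<close> is the componentwise product of the affine vectors
  \<open>A\<^sub>j x + b\<^sub>j\<close>, its flow is the product of their flows, and these are the given
  exponential series because a derivation commutes with matrices of constants (\<open>flow_affine\<close>).
\<close>

section \<open>Coefficients\<close>

lemma hcoeff_0 [simp]: "hcoeff 0 r = 0"
  by (simp add: zero_hurwitz.rep_eq)

lemma hcoeff_add [simp]: "hcoeff (f + g) r = hcoeff f r + hcoeff g r"
  by (simp add: plus_hurwitz.rep_eq)

lemma hcoeff_diff [simp]: "hcoeff (f - g) r = hcoeff f r - hcoeff g r"
  by (simp add: minus_hurwitz.rep_eq)

lemma hcoeff_sum [simp]: "hcoeff (sum f S) r = (\<Sum>i\<in>S. hcoeff (f i) r)"
  by (induction S rule: infinite_finite_induct) auto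

lemma hcoeff_hderiv [simp]: "hcoeff (hderiv l f) r = hcoeff f (r(l := Suc (r l)))"
  by (simp add: hderiv_def Abs_hurwitz_inverse)

lemma hcoeff_hconst: "hcoeff (hconst c) r = (if r = (\<lambda>_. 0) then c else 0)"
  by (simp add: hconst_def Abs_hurwitz_inverse)

lemma hcoeff_hvar: "hcoeff (hvar i) r = (if r = (\<lambda>k. if k = i then 1 else 0) then 1 else 0)"
  by (simp add: hvar_def Abs_hurwitz_inverse)

lemma hcoeff_hmap [simp]: "hcoeff (hmap h f) r = h (hcoeff f r)"
  by (simp add: hmap_def Abs_hurwitz_inverse)

lemma hcoeff_tseries [simp]: "hcoeff (tseries c) k = c (k ())"
  by (simp add: tseries_def Abs_hurwitz_inverse)

lemma hcoeff_hconst_mult [simp]: "hcoeff (hconst c * f) r = c * hcoeff f r"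
proof -
  have "hcoeff (hconst c * f) r =
    (\<Sum>s\<in>{..r}. if s = (\<lambda>_. 0) then c * hcoeff f r else 0)"
    unfolding times_hurwitz.rep_eq
    by (intro sum.cong refl) (auto simp: hcoeff_hconst mbinom_def fun_diff_def)
  also have "\<dots> = c * hcoeff f r"
    by (subst sum.delta) (auto simp: le_fun_def)
  finally show ?thesis .
qed

lemma hconst_of_nat: "hconst (of_nat c) = of_nat c"
proof (induction c)
  case 0
  show ?case by (rule hurwitz_eqI) (simp add: hcoeff_hconst)
next
  case (Suc c)
  have "hconst (of_nat (Suc c)) = 1 + (hconst (of_nat c) :: ('a, 'b) hurwitz)"
    by (rule hurwitz_eqI) (simp add: hcoeff_hconst one_hurwitz.rep_eq)
  then show ?case using Suc by simp
qed

lemma hcoeff_of_nat_mult [simp]: "hcoeff (of_nat c * f) r = of_nat c * hcoeff f r"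
  by (simp flip: hconst_of_nat)

lemma hcoeff_hvar_mult:
  "hcoeff (hvar i * f) r = of_nat (r i) * hcoeff f (r(i := r i - 1))"
proof -
  let ?e = "\<lambda>k. if k = i then 1 else 0 :: nat"
  have "hcoeff (hvar i * f) r =
    (\<Sum>s\<in>{..r}. if s = ?e then of_nat (mbinom r ?e) * hcoeff f (r - ?e) else 0)"
    unfolding times_hurwitz.rep_eq by (intro sum.cong refl) (auto simp: hcoeff_hvar)
  also have "\<dots> = (if ?e \<le> r then of_nat (mbinom r ?e) * hcoeff f (r - ?e) else 0)"
    by (subst sum.delta) auto
  also have "mbinom r ?e = r i"
  proof -
    have "mbinom r ?e = (\<Prod>k\<in>UNIV. if k = i then r k else 1)"
      unfolding mbinom_def by (intro prod.cong refl) auto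
    then show ?thesis by (simp add: prod.delta)
  qed
  also have "r - ?e = r(i := r i - 1)"
    by (auto simp: fun_eq_iff)
  also have "?e \<le> r \<longleftrightarrow> r i \<noteq> 0"
    by (auto simp: le_fun_def)
  finally show ?thesis by (simp add: fun_upd_def)
qed

lemma hcoeff_mult_unit:
  "hcoeff (f * g) (k :: unit \<Rightarrow> nat) =
    (\<Sum>l\<le>k (). of_nat (k () choose l) * hcoeff f (\<lambda>_. l) * hcoeff g (\<lambda>_. k () - l))"
  unfolding times_hurwitz.rep_eq
proof (rule sum.reindex_bij_witness [where i = "\<lambda>l _. l" and j = "\<lambda>s. s ()"])
  fix s assume s: "s \<in> {..k}"
  show "(\<lambda>_. s ()) = s" by (auto simp: fun_eq_iff)
  show "s () \<in> {..k ()}" using s by (auto simp: le_fun_def)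
  have "mbinom k s = k () choose s ()" by (simp add: mbinom_def UNIV_unit)
  moreover have "(\<lambda>_. s ()) = s" "(\<lambda>_. k () - s ()) = k - s" by (auto simp: fun_eq_iff)
  ultimately show "of_nat (k () choose s ()) * hcoeff f (\<lambda>_. s ()) * hcoeff g (\<lambda>_. k () - s ())
    = of_nat (mbinom k s) * hcoeff f s * hcoeff g (k - s)" by simp
qed (auto simp: le_fun_def)

section \<open>Derivations\<close>

text \<open>
  Pascal's rule in the variable \<open>l\<close>. Under truncated subtraction the second summand would be
  wrong at \<open>s l = 0\<close>.
\<close>

lemma mbinom_Suc:
  fixes r s :: "'n::finite \<Rightarrow> nat"
  shows "mbinom (r(l := Suc (r l))) s =
    mbinom r s + (if s l = 0 then 0 else mbinom r (s(l := s l - 1)))"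
proof -
  let ?P = "\<Prod>i\<in>UNIV - {l}. r i choose s i"
  have split: "mbinom u v = (u l choose v l) * (\<Prod>i\<in>UNIV - {l}. u i choose v i)"
    for u v :: "'n \<Rightarrow> nat"
    unfolding mbinom_def by (simp add: prod.remove)
  have "mbinom (r(l := Suc (r l))) s = (Suc (r l) choose s l) * ?P"
    by (subst split) (auto intro!: arg_cong2 [where f = "(*)"] prod.cong)
  moreover have "mbinom r (s(l := s l - 1)) = (r l choose (s l - 1)) * ?P"
    by (subst split) (auto intro!: arg_cong2 [where f = "(*)"] prod.cong)
  ultimately show ?thesis
    by (cases "s l") (auto simp: split [of r s] algebra_simps)
qed

lemma mbinom_eq_0: "\<not> s \<le> r \<Longrightarrow> mbinom r s = 0"
  by (auto simp: mbinom_def le_fun_def not_le intro!: binomial_eq_0)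

text \<open>
  Pascal's rule splits the coefficient of \<open>f * g\<close> at \<open>r + e\<^sub>l\<close> into two sums. In the first, the extra
  unit of degree is taken from \<open>g\<close>; in the second, it is taken from \<open>f\<close>.
\<close>

lemma hderiv_mult:
  "hderiv l (f * g) = hderiv l f * g + f * hderiv l (g :: ('a::comm_ring_1, 'n::finite) hurwitz)"
proof (rule hurwitz_eqI)
  fix r :: "'n \<Rightarrow> nat"
  let ?r = "r(l := Suc (r l))" and ?f = "hcoeff f" and ?g = "hcoeff g"
  let ?up = "\<lambda>s :: 'n \<Rightarrow> nat. s(l := Suc (s l))"
  have "hcoeff (hderiv l (f * g)) r =
    (\<Sum>s\<in>{..?r}. of_nat (mbinom r s) * ?f s * ?g (?r - s)) +
    (\<Sum>s\<in>{..?r}. of_nat (if s l = 0 then 0 else mbinom r (s(l := s l - 1))) * ?f s * ?g (?r - s))"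
    by (simp only: hcoeff_hderiv times_hurwitz.rep_eq mbinom_Suc of_nat_add
        distrib_right sum.distrib)
  also have "(\<Sum>s\<in>{..?r}. of_nat (mbinom r s) * ?f s * ?g (?r - s)) =
    (\<Sum>s\<in>{..r}. of_nat (mbinom r s) * ?f s * ?g (?up (r - s)))"
  proof (rule sum.mono_neutral_cong_right)
    show "{..r} \<subseteq> {..?r}" by (auto simp: le_fun_def intro: le_SucI)
    show "\<forall>s\<in>{..?r} - {..r}. of_nat (mbinom r s) * ?f s * ?g (?r - s) = 0"
      by (auto simp: mbinom_eq_0)
  next
    fix s assume "s \<in> {..r}"
    then have "?r - s = ?up (r - s)"
      by (auto simp: fun_eq_iff le_fun_def Suc_diff_le)
    then show "of_nat (mbinom r s) * ?f s * ?g (?r - s) =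
      of_nat (mbinom r s) * ?f s * ?g (?up (r - s))" by simp
  qed simp
  also have "\<dots> = hcoeff (f * hderiv l g) r"
    by (simp add: times_hurwitz.rep_eq)
  also have "(\<Sum>s\<in>{..?r}. of_nat (if s l = 0 then 0 else mbinom r (s(l := s l - 1))) * ?f s
      * ?g (?r - s)) =
    (\<Sum>s\<in>{s \<in> {..?r}. s l \<noteq> 0}. of_nat (mbinom r (s(l := s l - 1))) * ?f s * ?g (?r - s))"
    by (rule sum.mono_neutral_cong_right) auto
  also have "\<dots> = (\<Sum>s\<in>{..r}. of_nat (mbinom r s) * ?f (?up s) * ?g (r - s))"
  proof (rule sum.reindex_bij_witness [where i = ?up and j = "\<lambda>s. s(l := s l - 1)"])
    fix s assume s: "s \<in> {s \<in> {..?r}. s l \<noteq> 0}"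
    have le: "s k \<le> ?r k" for k using s by (auto simp only: le_fun_def mem_Collect_eq atMost_iff)
    show up: "?up (s(l := s l - 1)) = s" using s by auto
    show "s(l := s l - 1) \<in> {..r}"
      unfolding atMost_iff le_fun_def
    proof
      fix k show "(s(l := s l - 1)) k \<le> r k" using le[of k] by (cases "k = l") auto
    qed
    have "r - s(l := s l - 1) = ?r - s" using s by (auto simp: fun_eq_iff)
    with up show "of_nat (mbinom r (s(l := s l - 1))) * ?f (?up (s(l := s l - 1)))
        * ?g (r - s(l := s l - 1)) =
      of_nat (mbinom r (s(l := s l - 1))) * ?f s * ?g (?r - s)" by simp
  qed (auto simp: le_fun_def)
  also have "\<dots> = hcoeff (hderiv l f * g) r"
    by (simp add: times_hurwitz.rep_eq)
  finally show "hcoeff (hderiv l (f * g)) r = hcoeff (hderiv l f * g + f * hderiv l g) r"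
    by simp
qed

lemma hderiv_add: "hderiv l (f + g) = hderiv l f + hderiv l g"
  by (rule hurwitz_eqI) simp

lemma hderiv_hconst [simp]: "hderiv l (hconst c) = 0"
  by (rule hurwitz_eqI) (auto simp: hcoeff_hconst fun_eq_iff)

lemma hderiv_hvar: "hderiv l (hvar i) = (if l = i then 1 else 0)"
proof (rule hurwitz_eqI)
  fix r :: "'b \<Rightarrow> nat"
  have "r(l := Suc (r l)) = (\<lambda>k. if k = i then 1 else 0) \<longleftrightarrow> l = i \<and> r = (\<lambda>_. 0)"
    by (auto simp: fun_eq_iff split: if_splits)
  then show "hcoeff (hderiv l (hvar i)) r = hcoeff (if l = i then 1 else 0) r"
    by (simp add: hcoeff_hvar one_hurwitz.rep_eq)
qed

locale ring_derivation =
  fixes D :: "'b::comm_ring_1 \<Rightarrow> 'b"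
  assumes add: "D (f + g) = D f + D g"
    and mult: "D (f * g) = D f * g + f * D g"
begin

lemma zero [simp]: "D 0 = 0"
  using add[of 0 0] by simp

lemma one [simp]: "D 1 = 0"
  using mult[of 1 1] by simp

lemma sum: "D (sum f S) = (\<Sum>i\<in>S. D (f i))"
  by (induction S rule: infinite_finite_induct) (auto simp: add)

lemma const_mult: "D c = 0 \<Longrightarrow> D (c * f) = c * D f"
  by (simp add: mult)

lemma of_nat [simp]: "D (of_nat c) = 0"
  by (induction c) (auto simp: add)

lemma funpow_zero [simp]: "(D ^^ k) 0 = 0"
  by (induction k) auto

lemma funpow_add: "(D ^^ k) (f + g) = (D ^^ k) f + (D ^^ k) g"
  by (induction k) (auto simp: add)

lemma funpow_sum: "(D ^^ k) (sum f S) = (\<Sum>i\<in>S. (D ^^ k) (f i))"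
  by (induction S rule: infinite_finite_induct) (auto simp: funpow_add)

lemma funpow_const_mult: "D c = 0 \<Longrightarrow> (D ^^ k) (c * f) = c * (D ^^ k) f"
  by (induction k) (auto simp: const_mult)

lemma leibniz:
  "(D ^^ n) (f * g) = (\<Sum>l\<le>n. of_nat (n choose l) * (D ^^ l) f * (D ^^ (n - l)) g)"
proof (induction n)
  case 0
  show ?case by simp
next
  case (Suc n)
  let ?t = "\<lambda>l k. (D ^^ l) f * (D ^^ k) g"
  have "(D ^^ Suc n) (f * g) =
    (\<Sum>l\<le>n. of_nat (n choose l) * ?t (Suc l) (n - l)) +
    (\<Sum>l\<le>n. of_nat (n choose l) * ?t l (Suc n - l))"
    by (simp add: Suc sum mult const_mult mult.assoc distrib_left sum.distrib Suc_diff_le)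
  also have "(\<Sum>l\<le>n. of_nat (n choose l) * ?t l (Suc n - l)) =
    (\<Sum>l\<le>Suc n. of_nat (n choose l) * ?t l (Suc n - l))"
    by (simp add: binomial_eq_0)
  also have "\<dots> = ?t 0 (Suc n) + (\<Sum>l\<le>n. of_nat (n choose Suc l) * ?t (Suc l) (n - l))"
    by (subst sum.atMost_Suc_shift) simp
  also have "(\<Sum>l\<le>n. of_nat (n choose l) * ?t (Suc l) (n - l)) + \<dots> =
    ?t 0 (Suc n) + (\<Sum>l\<le>n. of_nat (Suc n choose Suc l) * ?t (Suc l) (n - l))"
    by (simp add: distrib_right sum.distrib add_ac)
  also have "\<dots> = (\<Sum>l\<le>Suc n. of_nat (Suc n choose l) * ?t l (Suc n - l))"
    by (subst sum.atMost_Suc_shift) simp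
  finally show ?case by (simp only: mult.assoc)
qed

text \<open>
  This is \<open>e\<^bsup>tD\<^esup> f = \<Sum>\<^sub>k D\<^sup>k f t\<^sup>k / k!\<close>, since the coefficients stored are those of \<open>t\<^sup>k / k!\<close>.
\<close>

definition exp_der :: "'b \<Rightarrow> ('b, unit) hurwitz" where
  "exp_der f = tseries (\<lambda>k. (D ^^ k) f)"

lemma hcoeff_exp_der [simp]: "hcoeff (exp_der f) k = (D ^^ k ()) f"
  by (simp add: exp_der_def)

text \<open>Both sides have the Leibniz expansion as their coefficient of \<open>t\<^sup>k / k!\<close>.\<close>

lemma exp_der_mult: "exp_der (f * g) = exp_der f * exp_der g"
  by (rule hurwitz_eqI) (simp add: hcoeff_mult_unit leibniz)

lemma exp_der_one: "exp_der 1 = 1"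
proof (rule hurwitz_eqI)
  fix k :: "unit \<Rightarrow> nat"
  have "k = (\<lambda>_. 0) \<longleftrightarrow> k () = 0" by (auto simp: fun_eq_iff)
  moreover have "(D ^^ n) 1 = (if n = 0 then 1 else 0)" for n
    by (cases n) (simp_all add: funpow_swap1)
  ultimately show "hcoeff (exp_der 1) k = hcoeff 1 k"
    by (simp add: one_hurwitz.rep_eq)
qed

lemma exp_der_power: "exp_der (f ^ n) = exp_der f ^ n"
  by (induction n) (simp_all add: exp_der_one exp_der_mult)

lemma exp_der_prod: "exp_der (prod f S) = (\<Prod>i\<in>S. exp_der (f i))"
  by (induction S rule: infinite_finite_induct) (simp_all add: exp_der_one exp_der_mult)

end

text \<open>The operator \<^const>\<open>Dop\<close> \<open>\<phi>\<close> on a single component.\<close>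

definition hder ::
    "('a::comm_ring_1, 'n::finite) hvec \<Rightarrow> ('a, 'n) hurwitz \<Rightarrow> ('a, 'n) hurwitz" where
  "hder \<phi> g = (\<Sum>l\<in>UNIV. hderiv l g * \<phi> $ l)"

interpretation hder: ring_derivation "hder \<phi>"
  by unfold_locales
    (simp_all add: hder_def hderiv_add hderiv_mult algebra_simps sum.distrib sum_distrib_left)

lemma hder_hconst [simp]: "hder \<phi> (hconst c) = 0"
  by (simp add: hder_def)

lemma hder_hvar: "hder \<phi> (hvar i) = \<phi> $ i"
proof -
  have "hder \<phi> (hvar i) = (\<Sum>l\<in>UNIV. if l = i then \<phi> $ l else 0)"
    unfolding hder_def by (intro sum.cong refl) (simp add: hderiv_hvar)
  then show ?thesis by simp
qed

lemma Dop_nth [simp]: "Dop \<phi> G $ i = hder \<phi> (G $ i)"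
  by (simp add: Dop_def hder_def)

lemma Dop_funpow_nth: "(Dop \<phi> ^^ k) G $ i = (hder \<phi> ^^ k) (G $ i)"
  by (induction k) simp_all

interpretation Dop: ring_derivation "Dop \<phi>"
  by unfold_locales (simp_all add: vec_eq_iff hder.add hder.mult)

lemma Dop_xvec [simp]: "Dop \<phi> xvec = \<phi>"
  by (simp add: vec_eq_iff xvec_def hder_hvar)

section \<open>A flow solves its differential equation\<close>

text \<open>
  The divided power \<open>x\<^sup>r / r!\<close>; a series is the infinite sum of its coefficients times these.
\<close>

definition hmonom :: "('n \<Rightarrow> nat) \<Rightarrow> ('a::zero_neq_one, 'n) hurwitz" where
  "hmonom r = Abs_hurwitz (\<lambda>s. if s = r then 1 else 0)"

lemma hcoeff_hmonom: "hcoeff (hmonom r) s = (if s = r then 1 else 0)"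
  by (simp add: hmonom_def Abs_hurwitz_inverse)

lemma hvar_mult_hmonom:
  "hvar i * hmonom r = of_nat (Suc (r i)) * hmonom (r(i := Suc (r i)))"
proof (rule hurwitz_eqI)
  fix s :: "'b \<Rightarrow> nat"
  have "s i \<noteq> 0 \<and> s(i := s i - 1) = r \<longleftrightarrow> s = r(i := Suc (r i))"
    by (auto simp: fun_eq_iff)
  then show "hcoeff (hvar i * hmonom r) s =
    hcoeff (of_nat (Suc (r i)) * hmonom (r(i := Suc (r i)))) s"
    by (auto simp: hcoeff_hvar_mult hcoeff_hmonom simp del: of_nat_Suc)
qed

lemma hvar_power_mult_hmonom:
  fixes r :: "'n::finite \<Rightarrow> nat"
  assumes "r i = 0"
  shows "hvar i ^ k * (hmonom r :: ('a::comm_ring_1, 'n) hurwitz) = of_nat (fact k) * hmonom (r(i := k))"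
proof (induction k)
  case 0
  have "r(i := 0) = r" using assms by auto
  then show ?case by simp
next
  case (Suc k)
  have "hvar i ^ Suc k * (hmonom r :: ('a, 'n) hurwitz) = hvar i * (hvar i ^ k * hmonom r)"
    by (simp add: mult.assoc)
  also have "\<dots> = of_nat (fact k) * (hvar i * hmonom (r(i := k)))"
    by (simp only: Suc mult.left_commute)
  also have "hvar i * hmonom (r(i := k)) = of_nat (Suc k) * hmonom (r(i := Suc k))"
    by (simp add: hvar_mult_hmonom del: of_nat_Suc)
  finally show ?case
    by (simp only: fact_Suc of_nat_mult of_nat_id mult_ac)
qed

lemma prod_hvar_power:
  fixes S :: "'n::finite set"
  assumes "finite S"
  shows "(\<Prod>i\<in>S. hvar i ^ r i :: ('a::comm_ring_1, 'n) hurwitz) =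
    of_nat (\<Prod>i\<in>S. fact (r i)) * hmonom (\<lambda>i. if i \<in> S then r i else 0)"
  using assms
proof (induction S)
  case empty
  have "(1 :: ('a, 'n) hurwitz) = hmonom (\<lambda>_. 0)"
    by (rule hurwitz_eqI) (simp add: one_hurwitz.rep_eq hcoeff_hmonom)
  then show ?case by simp
next
  case (insert i S)
  let ?r = "\<lambda>k. if k \<in> S then r k else 0"
  have "?r(i := r i) = (\<lambda>k. if k \<in> insert i S then r k else 0)" by auto
  moreover have "hvar i ^ r i * (hmonom ?r :: ('a, 'n) hurwitz) = of_nat (fact (r i)) * hmonom (?r(i := r i))"
    by (rule hvar_power_mult_hmonom) (use insert in auto)
  ultimately have step: "hvar i ^ r i * (hmonom ?r :: ('a, 'n) hurwitz) =
      of_nat (fact (r i)) * hmonom (\<lambda>k. if k \<in> insert i S then r k else 0)"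
    by simp
  have "(\<Prod>k\<in>insert i S. hvar k ^ r k :: ('a, 'n) hurwitz) =
      of_nat (\<Prod>k\<in>S. fact (r k)) * (hvar i ^ r i * hmonom ?r)"
    using insert by (simp only: prod.insert mult.left_commute not_False_eq_True)
  also have "\<dots> = of_nat (\<Prod>k\<in>insert i S. fact (r k)) *
      hmonom (\<lambda>k. if k \<in> insert i S then r k else 0)"
    unfolding step using insert by (simp add: mult_ac)
  finally show ?case .
qed

definition vanishes_below :: "nat \<Rightarrow> ('a::zero, 'n::finite) hurwitz \<Rightarrow> bool" where
  "vanishes_below N f \<longleftrightarrow> (\<forall>r. sum r UNIV < N \<longrightarrow> hcoeff f r = 0)"

lemma vanishes_below_mult: "vanishes_below N f \<Longrightarrow> vanishes_below N (f * g)"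
proof -
  assume f: "vanishes_below N f"
  have "hcoeff f s = 0" if "s \<le> r" "sum r UNIV < N" for r s
  proof -
    have "sum s UNIV \<le> sum r UNIV" using that by (auto intro!: sum_mono simp: le_fun_def)
    then show ?thesis using f that by (simp add: vanishes_below_def)
  qed
  then show ?thesis by (simp add: vanishes_below_def times_hurwitz.rep_eq)
qed

lemma vanishes_below_hder: "vanishes_below (Suc N) f \<Longrightarrow> vanishes_below N (hder \<phi> f)"
proof -
  assume f: "vanishes_below (Suc N) f"
  have "vanishes_below N (hderiv l f)" for l
  proof -
    have "sum (r(l := Suc (r l))) UNIV = Suc (sum r UNIV)" for r
      by (simp add: sum.remove [of _ l])
    then show ?thesis using f by (simp add: vanishes_below_def)
  qed
  then have "vanishes_below N (hderiv l f * \<phi> $ l)" for l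
    by (rule vanishes_below_mult)
  then show ?thesis by (simp add: vanishes_below_def hder_def)
qed

text \<open>
  This makes substitution of a flow well defined: terms of total degree at least \<open>N + k\<close>
  do not reach the coefficients of total degree below \<open>N\<close> of the \<open>k\<close>-th iterate.
\<close>

lemma vanishes_below_hder_funpow:
  "vanishes_below (N + k) f \<Longrightarrow> vanishes_below N ((hder \<phi> ^^ k) f)"
proof (induction k arbitrary: N)
  case (Suc k)
  from Suc.IH[of "Suc N"] Suc.prems show ?case
    by (simp add: vanishes_below_hder)
qed simp

lemma to_frac_0 [simp]: "to_frac 0 = 0"
  by (simp add: to_frac_def Zero_fract_def)

lemma to_frac_1 [simp]: "to_frac 1 = 1"
  by (simp add: to_frac_def One_fract_def)

lemma to_frac_add: "to_frac (a + b) = to_frac a + to_frac b"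
  by (simp add: to_frac_def)

lemma to_frac_mult: "to_frac (a * b) = to_frac a * to_frac b"
  by (simp add: to_frac_def)

lemma to_frac_of_nat [simp]: "to_frac (of_nat c) = of_nat c"
  by (induction c) (simp_all add: to_frac_add)

lemma to_frac_sum: "to_frac (sum f S) = (\<Sum>i\<in>S. to_frac (f i))"
  by (induction S rule: infinite_finite_induct) (simp_all add: to_frac_add)

lemma of_nat_fract_neq_0:
  "c \<noteq> 0 \<Longrightarrow> (of_nat c :: 'a::{idom, ring_char_0} fract) \<noteq> 0"
  by (simp flip: to_frac_of_nat add: to_frac_def Zero_fract_def eq_fract)

lemma flow_nth: "hmap (\<lambda>v. v $ i) (flow \<phi>) = hder.exp_der \<phi> (hvar i)"
  by (rule hurwitz_eqI) (simp add: flow_def Dop_funpow_nth xvec_def)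

text \<open>
  The flow is the image of \<open>x\<close> under the ring homomorphism \<open>e\<^bsup>tD\<^esup>\<close>, so the monomial in the
  components of the flow is the image of \<open>x\<^sup>r = r! (x\<^sup>r / r!)\<close>. The factorial cancels the
  denominator in the definition of substitution.
\<close>

lemma hcoeff_flow_monomial:
  "hcoeff (hcoeff (\<Prod>i\<in>UNIV. hmap (\<lambda>v. v $ i) (flow \<phi>) ^ r i) k) s =
    of_nat (\<Prod>i\<in>UNIV. fact (r i)) * hcoeff ((hder \<phi> ^^ k ()) (hmonom r)) s"
proof -
  have "(\<Prod>i\<in>UNIV. hmap (\<lambda>v. v $ i) (flow \<phi>) ^ r i) =
    hder.exp_der \<phi> (\<Prod>i\<in>UNIV. hvar i ^ r i)"
    by (simp only: flow_nth hder.exp_der_prod hder.exp_der_power)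
  also have "(\<Prod>i\<in>UNIV. hvar i ^ r i) = of_nat (\<Prod>i\<in>UNIV. fact (r i)) * hmonom r"
    by (simp add: prod_hvar_power)
  finally show ?thesis
    by (simp add: hder.funpow_const_mult del: of_nat_prod of_nat_fact)
qed

text \<open>
  A formal Taylor formula, \<open>g(\<Phi>) = e\<^bsup>tD\<^esup> g\<close>. At a fixed coefficient \<open>t\<^sup>k x\<^sup>s\<close>, the series \<open>g\<close> may be
  replaced by its polynomial part in a box that contains all exponents of total degree up to
  \<open>\<bar>s\<bar> + k\<close>; both sides then are the same finite sum of monomial contributions.
\<close>

lemma hsubst_flow:
  fixes g :: "('a::{idom, ring_char_0}, 'n::finite) hurwitz"
  shows "hsubst g (flow \<phi>) = hmap (hmap to_frac) (hder.exp_der \<phi> g)"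
proof (intro hurwitz_eqI)
  fix k :: "unit \<Rightarrow> nat" and s :: "'n \<Rightarrow> nat"
  let ?D = "hder \<phi> ^^ k ()"
  let ?N = "Suc (sum s UNIV)"
  let ?S = "{..(\<lambda>_. ?N + k ()) :: 'n \<Rightarrow> nat}"
  \<comment> \<open>Order \<open>\<bar>s\<bar> + 1 + k\<close> is enough for the \<open>k\<close>-th iterate to vanish at \<open>s\<close>.\<close>
  have low: "hcoeff (?D f) s = 0" if "vanishes_below (?N + k ()) f" for f
    using vanishes_below_hder_funpow[OF that] by (simp add: vanishes_below_def)
  have in_S: "r \<in> ?S" if "sum r UNIV < ?N + k ()" for r :: "'n \<Rightarrow> nat"
  proof -
    have "r i \<le> sum r UNIV" for i by (rule member_le_sum) auto
    then have "r i \<le> ?N + k ()" for i using that by (meson le_trans less_imp_le)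
    then show ?thesis by (simp add: le_fun_def)
  qed
  have monom: "hcoeff (?D (hmonom r)) s = 0" if "r \<notin> ?S" for r
    using that in_S by (intro low) (auto simp: vanishes_below_def hcoeff_hmonom)
  define h where "h = (\<Sum>r\<in>?S. hconst (hcoeff g r) * hmonom r)"
  have "hcoeff h r = hcoeff g r" if "r \<in> ?S" for r
    using that by (simp add: h_def hcoeff_hmonom if_distrib cong: if_cong)
  then have "vanishes_below (?N + k ()) (g - h)"
    unfolding vanishes_below_def using in_S by (auto simp del: atMost_iff)
  then have "hcoeff (?D (g - h)) s = 0" by (rule low)
  moreover have "?D g = ?D (g - h) + ?D h"
    by (simp flip: hder.funpow_add)
  ultimately have "hcoeff (?D g) s = hcoeff (?D h) s"
    by simp
  also have "\<dots> = (\<Sum>r\<in>?S. hcoeff g r * hcoeff (?D (hmonom r)) s)"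
    by (simp add: h_def hder.funpow_sum hder.funpow_const_mult)
  finally have Dg: "hcoeff (?D g) s = \<dots>" .
  have "hcoeff (hcoeff (hsubst g (flow \<phi>)) k) s =
    Sum_any (\<lambda>r. to_frac (hcoeff g r * hcoeff (?D (hmonom r)) s))"
  proof -
    have "to_frac (hcoeff g r) / of_nat (\<Prod>i\<in>UNIV. fact (r i)) *
        to_frac (of_nat (\<Prod>i\<in>UNIV. fact (r i)) * hcoeff (?D (hmonom r)) s) =
      to_frac (hcoeff g r * hcoeff (?D (hmonom r)) s)" for r
      using of_nat_fract_neq_0[of "\<Prod>i\<in>UNIV. fact (r i)", where 'a = 'a]
      by (simp add: to_frac_mult del: of_nat_prod of_nat_fact)
    then show ?thesis
      by (simp add: hsubst_def Abs_hurwitz_inverse hcoeff_flow_monomial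
          del: of_nat_prod of_nat_fact)
  qed
  also have "\<dots> = (\<Sum>r\<in>?S. to_frac (hcoeff g r * hcoeff (?D (hmonom r)) s))"
    by (rule Sum_any.expand_superset) (use monom in \<open>force simp del: atMost_iff\<close>)+
  also have "\<dots> = to_frac (hcoeff (?D g) s)"
    by (simp add: Dg to_frac_sum)
  finally show "hcoeff (hcoeff (hsubst g (flow \<phi>)) k) s =
      hcoeff (hcoeff (hmap (hmap to_frac) (hder.exp_der \<phi> g)) k) s"
    by simp
qed

text \<open>
  As \<open>D x\<^sub>i = \<phi>\<^sub>i\<close>, the \<open>t\<close>-derivative of \<open>\<Phi>\<^sub>i = e\<^bsup>tD\<^esup> x\<^sub>i\<close> is \<open>e\<^bsup>tD\<^esup> \<phi>\<^sub>i = \<phi>\<^sub>i(\<Phi>)\<close>.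
\<close>

theorem is_solution_flow:
  fixes \<phi> :: "('a::{idom, ring_char_0}, 'n::finite) hvec"
  shows "is_solution \<phi> (flow \<phi>)"
  unfolding is_solution_def
proof (intro conjI allI)
  show "tcoeff (flow \<phi>) 0 = xvec"
    by (simp add: tcoeff_def flow_def)
  fix i
  show "hmap (\<lambda>v. hmap to_frac (v $ i)) (hderiv () (flow \<phi>)) = hsubst (\<phi> $ i) (flow \<phi>)"
    unfolding hsubst_flow
    by (rule hurwitz_eqI)
      (simp add: flow_def Dop_funpow_nth funpow_swap1 hder_hvar xvec_def)
qed

section \<open>Products of flows\<close>

text \<open>The generator is the coefficient of \<open>t\<close>.\<close>

lemma inj_flow: "inj flow"
proof (rule injI)
  fix \<phi> \<psi> :: "('a::comm_ring_1, 'n::finite) hvec"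
  assume "flow \<phi> = flow \<psi>"
  then have "hcoeff (flow \<phi>) (\<lambda>_. 1) = hcoeff (flow \<psi>) (\<lambda>_. 1)" by simp
  then show "\<phi> = \<psi>" by (simp add: flow_def)
qed

text \<open>
  With \<open>D\<close> the derivation of \<open>\<phi> * \<psi>\<close>, the coefficient of \<open>t\<^bsup>k+1\<^esup> / (k+1)!\<close> on the right is
  \<open>D\<^bsup>k+1\<^esup> x = D\<^sup>k (\<phi> * \<psi>)\<close>, whose Leibniz expansion defines the coefficient on the left.
\<close>

lemma flow_times_flow: "flow \<phi> \<odot>\<^sub>F flow \<psi> = flow (\<phi> * \<psi>)"
proof -
  have the_flow: "(THE \<zeta>. flow \<zeta> = flow \<eta>) = \<eta>" for \<eta> :: "('a, 'b) hvec"
    by (rule the_equality) (auto dest: injD[OF inj_flow])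
  have "flow_prod_coeff \<phi> \<psi> = (\<lambda>r. (Dop (\<phi> * \<psi>) ^^ r) xvec)"
  proof
    fix r
    show "flow_prod_coeff \<phi> \<psi> r = (Dop (\<phi> * \<psi>) ^^ r) xvec"
    proof (cases r)
      case (Suc k)
      have "(Dop (\<phi> * \<psi>) ^^ r) xvec = (Dop (\<phi> * \<psi>) ^^ k) (\<phi> * \<psi>)"
        by (simp add: Suc funpow_swap1)
      then show ?thesis by (simp add: Suc Dop.leibniz)
    qed simp
  qed
  then show ?thesis
    by (simp add: flow_times_def the_flow flow_def [of "\<phi> * \<psi>"])
qed

lemma flow_Prod_flow:
  assumes "m \<ge> 1"
  shows "flow_Prod (\<lambda>j. flow (\<phi> j)) m = flow (\<Prod>j = 1..m. \<phi> j)"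
  using assms
proof (induction m rule: dec_induct)
  case base
  show ?case by (simp add: flow_Prod_def)
next
  case (step m)
  then show ?case by (simp add: flow_Prod_def flow_times_flow mult.commute)
qed

section \<open>Affine flows\<close>

lemma mat_act_nth [simp]: "mat_act A v $ l = (\<Sum>i\<in>UNIV. hconst (A $ l $ i) * v $ i)"
  by (simp add: mat_act_def matrix_vector_mult_def)

lemma mat_act_add: "mat_act A (v + w) = mat_act A v + mat_act A w"
  by (simp add: vec_eq_iff distrib_left sum.distrib)

lemma mat_act_funpow_add: "(mat_act A ^^ k) (v + w) = (mat_act A ^^ k) v + (mat_act A ^^ k) w"
  by (induction k) (simp_all add: mat_act_add)

lemma Dop_mat_act: "Dop \<phi> (mat_act A v) = mat_act A (Dop \<phi> v)"
  by (simp add: vec_eq_iff hder.sum hder.const_mult)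

lemma Dop_mat_act_funpow: "Dop \<phi> ((mat_act A ^^ k) v) = (mat_act A ^^ k) (Dop \<phi> v)"
  by (induction k) (simp_all add: Dop_mat_act)

lemma Dop_const_vec [simp]: "Dop \<phi> (const_vec b) = 0"
  by (simp add: vec_eq_iff const_vec_def)

text \<open>
  For \<open>\<phi> = A x + b\<close> the operator \<open>D\<close> commutes with \<open>A\<close> and kills \<open>b\<close>, so \<open>D \<phi> = A (D x) = A \<phi>\<close> and
  \<open>D\<^bsup>k+1\<^esup> x = A\<^sup>k \<phi> = A\<^bsup>k+1\<^esup> x + A\<^sup>k b\<close>.
\<close>

lemma flow_affine: "flow (mat_act A xvec + const_vec b) = exp_series A xvec + int_exp_series A b"
proof -
  define \<phi> where "\<phi> = mat_act A xvec + const_vec b"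
  have D\<phi>: "Dop \<phi> \<phi> = mat_act A \<phi>"
    by (subst (2) \<phi>_def) (simp add: Dop.add Dop_mat_act)
  have "(Dop \<phi> ^^ k) \<phi> = (mat_act A ^^ k) \<phi>" for k
    by (induction k) (simp_all add: Dop_mat_act_funpow D\<phi> funpow_swap1)
  then have "(Dop \<phi> ^^ Suc k) xvec = (mat_act A ^^ Suc k) xvec + (mat_act A ^^ k) (const_vec b)"
    for k
    by (simp add: funpow_Suc_right \<phi>_def mat_act_funpow_add del: funpow.simps)
  then have "(Dop \<phi> ^^ k) xvec = (mat_act A ^^ k) xvec +
      (case k of 0 \<Rightarrow> 0 | Suc r \<Rightarrow> (mat_act A ^^ r) (const_vec b))" for k
    by (cases k) (simp_all del: funpow.simps(2))
  then show ?thesis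
    unfolding \<phi>_def [symmetric]
    by (intro hurwitz_eqI) (simp add: flow_def exp_series_def int_exp_series_def)
qed

theorem theorem13:
  fixes a :: "'n::finite \<Rightarrow> 'n \<Rightarrow> nat \<Rightarrow> 'a::{idom, ring_char_0}"
    and b :: "'n \<Rightarrow> nat \<Rightarrow> 'a"
    and m :: nat
    and F :: "('a, 'n) hvec"
    and A :: "nat \<Rightarrow> 'a^'n^'n"
    and B :: "nat \<Rightarrow> 'a^'n"
  assumes "m \<ge> 1"
    and "F = (\<chi> l. \<Prod>j = 1..m. (\<Sum>i\<in>UNIV. hconst (a l i j) * hvar i) + hconst (b l j))"
    and "A = (\<lambda>j. \<chi> l i. a l i j)"
    and "B = (\<lambda>j. \<chi> l. b l j)"
  shows "is_solution F (flow F)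
    \<and> (\<forall>j\<in>{1..m}. exp_series (A j) xvec + int_exp_series (A j) (B j) \<in> flows)
    \<and> flow F = flow_Prod (\<lambda>j. exp_series (A j) xvec + int_exp_series (A j) (B j)) m"
proof (intro conjI ballI)
  let ?\<phi> = "\<lambda>j. mat_act (A j) xvec + const_vec (B j)"
  show "is_solution F (flow F)"
    by (rule is_solution_flow)
  show "exp_series (A j) xvec + int_exp_series (A j) (B j) \<in> flows" for j
    by (simp add: flows_def flip: flow_affine)
  have prod_nth: "(\<Prod>j\<in>S. f j) $ l = (\<Prod>j\<in>S. f j $ l)"
    for S and f :: "nat \<Rightarrow> ('a, 'n) hvec" and l
    by (induction S rule: infinite_finite_induct) simp_all
  have "F = (\<Prod>j = 1..m. ?\<phi> j)"
    by (simp add: vec_eq_iff prod_nth assms(2-4) const_vec_def xvec_def)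
  then show "flow F = flow_Prod (\<lambda>j. exp_series (A j) xvec + int_exp_series (A j) (B j)) m"
    using flow_Prod_flow[OF assms(1), of ?\<phi>] by (simp only: flow_affine)
qed

end
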